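(* Let $L$ be a finite lower dismantlable lattice which is an adjunct of $n$ chains, where $n\ge 2$. Then $V(G_{\{0\}}(L))\neq\emptyset$ and $\mathrm{diam}(G_{\{0\}}(L))\le 2$. Moreover, if $(0,1)$ is the only adjunct pair in $L$, then $\mathrm{diam}(G_{\{0\}}(L))=1$ if and only if $L\cong\mathcal{M}_n$. Further: (a) $\mathrm{gr}(G_{\{0\}}(L))=3$ if and only if $L$ is an adjunct of at least three chains; (b) $\mathrm{gr}(G_{\{0\}}(L))=4$ if and only if $L=C_1]_0^aC_2$ with $|C_2|\ge 2$; (c) $\mathrm{gr}(G_{\{0\}}(L))=\infty$ if and only if $L=C_1]_0^aC_2$ with $|C_2|=1$.
   Context: Adjunct operation: for disjoint finite lattices $L_1,L_2$ and $a<b$ in $L_1$ with $b$ not covering $a$, $L_1]_a^bL_2$ is $L_1\cup L_2$ ordered by: $x\le y$ iff ($x,y\in L_1$, $x\le y$ in $L_1$) or ($x,y\in L_2$, $x\le y$ in $L_2$) or ($x\in L_1$, $y\in L_2$, $x\le a$) or ($x\in L_2$, $y\in L_1$, $b\le y$); $(a,b)$ is an adjunct pair. A finite lattice is dismantlable iff it is an adjunct of chains $C_0]_{a_1}^{b_1}C_1\cdots]_{a_n}^{b_n}C_n$; lower dismantlable if it is a chain or every adjunct pair is of the form $(0,b)$. $C_1,C_2$ denote chains. $\mathcal{M}_n=\{0,1,a_1,\dots,a_n\}$ is the lattice with $0<a_i<1$, $a_i\wedge a_j=0$ and $a_i\vee a_j=1$ for $i\ne j$. The zero-divisor graph $G_{\{0\}}(L)$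 has vertex set $\{x\in L\setminus\{0\}: x\wedge y=0\text{ for some }y\in L\setminus\{0\}\}$, distinct vertices $x,y$ adjacent iff $x\wedge y=0$. The diameter is the maximum distance between vertices; the girth $\mathrm{gr}$ is the length of a shortest cycle, $\infty$ if there is no cycle.
   Formalization: In (b), C_2 is additionally required to have at most as many elements as the part of C_1 strictly between 0 and a; without this (b) fails, e.g. for the pentagon {0<c<1}]_0^1{x<y}, which has |C_2|=2 but girth infinity. *)

theory Defs
  imports
    "HOL-Algebra.Lattice"
    "HOL-Library.Extended_Nat"
    "Graph_Theory.Pair_Digraph"
    "Graph_Theory.Shortest_Path"
begin

definition finite_lattice :: "'a gorder \<Rightarrow> bool" where
  "finite_lattice L \<longleftrightarrow> lattice L \<and> finite (carrier L) \<and> carrier L \<noteq> {}"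

definition finite_chain :: "'a gorder \<Rightarrow> bool" where
  "finite_chain C \<longleftrightarrow> total_order C \<and> finite (carrier C) \<and> carrier C \<noteq> {}"

definition between :: "'a gorder \<Rightarrow> 'a \<Rightarrow> 'a \<Rightarrow> 'a set" where
  "between L a b = {x \<in> carrier L. a \<sqsubset>\<^bsub>L\<^esub> x \<and> x \<sqsubset>\<^bsub>L\<^esub> b}"

definition covered_by :: "'a gorder \<Rightarrow> 'a \<Rightarrow> 'a \<Rightarrow> bool" where
  "covered_by L a b \<longleftrightarrow> a \<sqsubset>\<^bsub>L\<^esub> b \<and> between L a b = {}"

text \<open>Records of type \<^typ>\<open>'a gorder\<close> may differ in the value of \<^const>\<open>le\<close> outside the
  carrier; this relation is equality of the ordered sets they describe.\<close>

definition same_order :: "'a gorder \<Rightarrow> 'a gorder \<Rightarrow> bool" where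
  "same_order L M \<longleftrightarrow>
     carrier L = carrier M \<and> eq L = eq M \<and>
     (\<forall>x\<in>carrier L. \<forall>y\<in>carrier L. x \<sqsubseteq>\<^bsub>L\<^esub> y \<longleftrightarrow> x \<sqsubseteq>\<^bsub>M\<^esub> y)"

definition adjunct :: "'a gorder \<Rightarrow> 'a \<Rightarrow> 'a \<Rightarrow> 'a gorder \<Rightarrow> 'a gorder" where
  "adjunct L1 a b L2 =
     \<lparr> carrier = carrier L1 \<union> carrier L2,
       eq = (=),
       le = (\<lambda>x y.
         x \<in> carrier L1 \<and> y \<in> carrier L1 \<and> x \<sqsubseteq>\<^bsub>L1\<^esub> y \<or>
         x \<in> carrier L2 \<and> y \<in> carrier L2 \<and> x \<sqsubseteq>\<^bsub>L2\<^esub> y \<or>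
         x \<in> carrier L1 \<and> y \<in> carrier L2 \<and> x \<sqsubseteq>\<^bsub>L1\<^esub> a \<or>
         x \<in> carrier L2 \<and> y \<in> carrier L1 \<and> b \<sqsubseteq>\<^bsub>L1\<^esub> y) \<rparr>"

definition is_adjunct :: "'a gorder \<Rightarrow> 'a gorder \<Rightarrow> 'a \<Rightarrow> 'a \<Rightarrow> 'a gorder \<Rightarrow> bool" where
  "is_adjunct L L1 a b L2 \<longleftrightarrow>
     finite_lattice L1 \<and> finite_lattice L2 \<and> carrier L1 \<inter> carrier L2 = {} \<and>
     a \<in> carrier L1 \<and> b \<in> carrier L1 \<and> a \<sqsubset>\<^bsub>L1\<^esub> b \<and> \<not> covered_by L1 a b \<and>
     same_order L (adjunct L1 a b L2)"

text \<open>\<open>adjunct_rep ps L\<close>: \<open>L\<close> is an adjunct of chains, the first of which is not glued, and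
  \<open>ps\<close> lists the adjunct pairs of the others in order, so the number of chains is
  \<open>length ps + 1\<close>.\<close>

inductive adjunct_rep :: "('a \<times> 'a) list \<Rightarrow> 'a gorder \<Rightarrow> bool" where
  chain: "finite_chain C \<Longrightarrow> adjunct_rep [] C"
| glue: "adjunct_rep ps L1 \<Longrightarrow> finite_chain C \<Longrightarrow> is_adjunct L L1 a b C
    \<Longrightarrow> adjunct_rep (ps @ [(a, b)]) L"

definition adjunct_of_chains :: "nat \<Rightarrow> 'a gorder \<Rightarrow> bool" where
  "adjunct_of_chains n L \<longleftrightarrow> (\<exists>ps. adjunct_rep ps L \<and> length ps + 1 = n)"

text \<open>The adjunct pairs, with multiplicities, are the same in every representation of a
  dismantlable lattice, so it does not matter which representation the next two notions
  refer to.\<close>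

definition lower_dismantlable :: "'a gorder \<Rightarrow> bool" where
  "lower_dismantlable L \<longleftrightarrow>
     (\<exists>ps. adjunct_rep ps L \<and> (\<forall>(a, b)\<in>set ps. a = \<bottom>\<^bsub>L\<^esub>))"

definition only_adjunct_pair :: "'a gorder \<Rightarrow> 'a \<times> 'a \<Rightarrow> bool" where
  "only_adjunct_pair L p \<longleftrightarrow> (\<exists>ps. adjunct_rep ps L \<and> set ps = {p})"

text \<open>An adjunct of two chains, glued at a pair \<open>(\<bottom>, a)\<close>, does not determine which of the two
  strands between \<open>\<bottom>\<close> and \<open>a\<close> is the glued chain \<open>C2\<close>: the other strand is
  \<open>between C1 \<bottom> a\<close>, and exchanging them represents the same lattice. So a size of \<open>C2\<close> is a
  property of the lattice only when \<open>C2\<close> is taken to be a shorter strand, that is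
  \<open>card (carrier C2) \<le> card (between C1 \<bottom> a)\<close>. For example, the pentagon \<open>N5\<close> arises with
  \<open>card (carrier C2) = 1\<close> and with \<open>card (carrier C2) = 2\<close>. When \<open>card (carrier C2) = 1\<close> the
  inequality is automatic, because \<open>a\<close> does not cover \<open>\<bottom>\<close>.\<close>

datatype M_elem = M_zero | M_one | M_atom nat

definition M_lat :: "nat \<Rightarrow> M_elem gorder" where
  "M_lat n =
     \<lparr> carrier = {M_zero, M_one} \<union> M_atom ` {1..n},
       eq = (=),
       le = (\<lambda>x y. x = M_zero \<or> y = M_one \<or> x = y) \<rparr>"

definition order_iso :: "'a gorder \<Rightarrow> 'b gorder \<Rightarrow> bool" where
  "order_iso L M \<longleftrightarrow> (\<exists>f. order_emb L M f \<and> bij_betw f (carrier L) (carrier M))"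

definition zero_divisors :: "'a gorder \<Rightarrow> 'a set" where
  "zero_divisors L =
     {x \<in> carrier L - {\<bottom>\<^bsub>L\<^esub>}. \<exists>y\<in>carrier L - {\<bottom>\<^bsub>L\<^esub>}. x \<sqinter>\<^bsub>L\<^esub> y = \<bottom>\<^bsub>L\<^esub>}"

text \<open>Simple graphs are represented as symmetric loop-free digraphs.\<close>

definition zero_divisor_graph :: "'a gorder \<Rightarrow> 'a pair_pre_digraph" where
  "zero_divisor_graph L =
     \<lparr> pverts = zero_divisors L,
       parcs = {(x, y). x \<in> zero_divisors L \<and> y \<in> zero_divisors L \<and> x \<noteq> y \<and>
                  x \<sqinter>\<^bsub>L\<^esub> y = \<bottom>\<^bsub>L\<^esub>} \<rparr>"

definition graph_dist :: "'a pair_pre_digraph \<Rightarrow> 'a \<Rightarrow> 'a \<Rightarrow> ereal" where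
  "graph_dist G u v = wf_digraph.\<mu> (with_proj G) (\<lambda>_. 1) u v"

definition graph_diam :: "'a pair_pre_digraph \<Rightarrow> ereal" where
  "graph_diam G = (SUP u\<in>pverts G. SUP v\<in>pverts G. graph_dist G u v)"

text \<open>The bound \<open>3 \<le> length p\<close> excludes traversing one undirected edge back and forth,
  which is a cycle of the symmetric digraph.\<close>

definition girth :: "'a pair_pre_digraph \<Rightarrow> enat" where
  "girth G =
     (INF p\<in>{p. pre_digraph.cycle (with_proj G) p \<and> 3 \<le> length p}. enat (length p))"

end

theory Submission
  imports Defs
begin

text \<open>In a lower dismantlable lattice the elements above a nonzero element form a chain. So the
  meet of two nonzero elements is zero exactly when they are incomparable, and the zero-divisor
  graph is the incomparability graph on the elements that have an incomparable partner. Gluing a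
  chain at a pair \<open>(0, b)\<close> adds exactly one atom, the least element of the chain, so the number of
  chains in any representation is the number of atoms. Three atoms span a triangle, and the
  vertices of a triangle lie above three distinct atoms. With two chains the graph is complete
  bipartite, its parts being the two strands between \<open>0\<close> and \<open>b\<close>, and either strand may be
  regarded as the glued one. If all pairs are \<open>(0, 1)\<close>, then also the elements below an element
  other than \<open>1\<close> form a chain, so every element other than \<open>0\<close> and \<open>1\<close> is a vertex.\<close>

section \<open>Distance, diameter and girth of graphs\<close>

context pair_wf_digraph
begin

text \<open>\<open>\<mu>\<close> is the infimum of the costs of walks, and with unit weights the
  cost of a walk is its number of arcs.\<close>

lemma graph_dist_eq: "graph_dist G u v = (INF p\<in>{p. awalk u p v}. ereal (real (length p)))"
proof -
  have "awalk_cost (\<lambda>_. 1) p = real (length p)" for p :: "('a \<times> 'a) list"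
    by (induction p) auto
  then show ?thesis
    unfolding graph_dist_def \<mu>_def by simp
qed

lemma graph_dist_le:
  "awalk u p v \<Longrightarrow> graph_dist G u v \<le> ereal (real (length p))"
  unfolding graph_dist_eq by (rule INF_lower) simp

lemma graph_dist_self: "u \<in> pverts G \<Longrightarrow> graph_dist G u u \<le> 0"
  using graph_dist_le[of u "[]" u] by (simp add: awalk_Nil_iff zero_ereal_def)

lemma graph_dist_arc: "(u, v) \<in> parcs G \<Longrightarrow> graph_dist G u v \<le> 1"
  using graph_dist_le[of u "[(u, v)]" v] arc_fst_in_verts arc_snd_in_verts
  by (fastforce simp: awalk_def one_ereal_def)

lemma graph_dist_arc2:
  "(u, w) \<in> parcs G \<Longrightarrow> (w, v) \<in> parcs G \<Longrightarrow> graph_dist G u v \<le> 2"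
  using graph_dist_le[of u "[(u, w), (w, v)]" v] arc_fst_in_verts arc_snd_in_verts
  by (fastforce simp: awalk_def)

lemma graph_dist_ge_1: "u \<noteq> v \<Longrightarrow> 1 \<le> graph_dist G u v"
  unfolding graph_dist_eq
proof (rule INF_greatest)
  fix p assume "u \<noteq> v" "p \<in> {p. awalk u p v}"
  then have "p \<noteq> []" by (auto simp: awalk_Nil_iff)
  then have "1 \<le> length p" by (cases p) auto
  then show "1 \<le> ereal (real (length p))" by (simp add: one_ereal_def)
qed

text \<open>An infimum below 2 is witnessed by a walk with fewer than two arcs, and between distinct
  vertices that walk is not empty.\<close>

lemma arc_if_graph_dist_less_2:
  assumes "graph_dist G u v < 2" "u \<noteq> v"
  shows "(u, v) \<in> parcs G"
proof -
  obtain p where p: "awalk u p v" "ereal (real (length p)) < 2"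
    using assms(1) unfolding graph_dist_eq by (auto simp: INF_less_iff)
  then have "length p < 2" by simp
  moreover have "p \<noteq> []" using p(1) assms(2) by (auto simp: awalk_Nil_iff)
  ultimately obtain e where "p = [e]"
    by (cases p; cases "tl p") auto
  with p(1) show ?thesis by (auto simp: awalk_def)
qed

lemma graph_diam_le:
  "(\<And>u v. u \<in> pverts G \<Longrightarrow> v \<in> pverts G \<Longrightarrow> graph_dist G u v \<le> d) \<Longrightarrow> graph_diam G \<le> d"
  unfolding graph_diam_def by (intro SUP_least)

lemma graph_dist_le_diam:
  "u \<in> pverts G \<Longrightarrow> v \<in> pverts G \<Longrightarrow> graph_dist G u v \<le> graph_diam G"
  unfolding graph_diam_def by (meson SUP_upper2 order_refl)

text \<open>Completeness alone does not give the value 1, since a single vertex has diameter 0; the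
  two distinct vertices supply the lower bound.\<close>

lemma graph_diam_eq_1_iff:
  assumes "u0 \<in> pverts G" "v0 \<in> pverts G" "u0 \<noteq> v0"
  shows "graph_diam G = 1 \<longleftrightarrow>
    (\<forall>u\<in>pverts G. \<forall>v\<in>pverts G. u \<noteq> v \<longrightarrow> (u, v) \<in> parcs G)" (is "_ \<longleftrightarrow> ?complete")
proof
  assume diam: "graph_diam G = 1"
  show ?complete
  proof (intro ballI impI)
    fix u v assume "u \<in> pverts G" "v \<in> pverts G" "u \<noteq> v"
    then have "graph_dist G u v \<le> 1" using graph_dist_le_diam diam by metis
    also have "(1::ereal) < 2" by simp
    finally show "(u, v) \<in> parcs G" using \<open>u \<noteq> v\<close> arc_if_graph_dist_less_2 by blast
  qed
next
  assume complete: ?complete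
  have "graph_diam G \<le> 1"
  proof (rule graph_diam_le)
    fix u v assume "u \<in> pverts G" "v \<in> pverts G"
    then show "graph_dist G u v \<le> 1"
      using complete graph_dist_arc graph_dist_self[of u] order_trans[of _ "0::ereal" 1]
      by (cases "u = v") auto
  qed
  moreover have "1 \<le> graph_diam G"
    using assms graph_dist_ge_1 graph_dist_le_diam order_trans by metis
  ultimately show "graph_diam G = 1" by (rule antisym)
qed

lemma girth_le: "cycle p \<Longrightarrow> 3 \<le> length p \<Longrightarrow> girth G \<le> enat (length p)"
  unfolding girth_def by (rule INF_lower) simp

lemma girth_ge:
  "(\<And>p. cycle p \<Longrightarrow> 3 \<le> length p \<Longrightarrow> k \<le> enat (length p)) \<Longrightarrow> k \<le> girth G"
  unfolding girth_def by (rule INF_greatest) simp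

lemma girth_ge_3: "3 \<le> girth G"
  by (rule girth_ge) (simp add: numeral_eq_enat)

lemma girth_le_3:
  assumes "(x, y) \<in> parcs G" "(y, z) \<in> parcs G" "(z, x) \<in> parcs G" "distinct [x, y, z]"
  shows "girth G \<le> 3"
proof -
  have "cycle [(x, y), (y, z), (z, x)]"
    unfolding cycle_def awalk_def using assms arc_fst_in_verts by (fastforce simp: awalk_def)
  from girth_le[OF this] show ?thesis by (simp add: numeral_eq_enat eval_nat_numeral)
qed

lemma girth_le_4:
  assumes "(x, y) \<in> parcs G" "(y, z) \<in> parcs G" "(z, w) \<in> parcs G" "(w, x) \<in> parcs G"
    and "distinct [x, y, z, w]"
  shows "girth G \<le> 4"
proof -
  have "cycle [(x, y), (y, z), (z, w), (w, x)]"
    unfolding cycle_def awalk_def using assms arc_fst_in_verts by (fastforce simp: awalk_def)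
  from girth_le[OF this] show ?thesis by (simp add: numeral_eq_enat eval_nat_numeral)
qed

lemma cycle_length_3E:
  assumes "cycle p" "length p = 3"
  obtains x y z where "(x, y) \<in> parcs G" "(y, z) \<in> parcs G" "(z, x) \<in> parcs G" "distinct [x, y, z]"
proof -
  obtain e1 e2 e3 where p: "p = [e1, e2, e3]"
    using assms(2) by (auto simp: numeral_3_eq_3 length_Suc_conv)
  show thesis
    using assms(1) that[of "fst e1" "fst e2" "fst e3"]
    unfolding p cycle_def awalk_def by (cases e1; cases e2; cases e3) auto
qed

lemma girth_ge_4:
  assumes "\<And>x y z. (x, y) \<in> parcs G \<Longrightarrow> (y, z) \<in> parcs G \<Longrightarrow> (z, x) \<in> parcs G \<Longrightarrow>
    distinct [x, y, z] \<Longrightarrow> False"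
  shows "4 \<le> girth G"
proof (rule girth_ge)
  fix p assume p: "cycle p" "3 \<le> length p"
  with assms have "length p \<noteq> 3" by (meson cycle_length_3E)
  with p(2) have "4 \<le> length p" by simp
  then show "4 \<le> enat (length p)" by (simp add: numeral_eq_enat)
qed

text \<open>In a cycle of length at least 3 the first and the third arc share a vertex only if the
  cycle is a triangle, and then the second arc misses that vertex. So no vertex lies on all three
  arcs.\<close>

lemma girth_star:
  assumes "\<And>u v. (u, v) \<in> parcs G \<Longrightarrow> u = c \<or> v = c"
  shows "girth G = \<infinity>"
proof -
  have False if p: "cycle p" "3 \<le> length p" for p
  proof -
    obtain e1 e2 e3 es where es: "p = e1 # e2 # e3 # es"
      using p(2) by (cases p; cases "tl p"; cases "tl (tl p)") auto
    obtain u where u: "pcas u p u" "set p \<subseteq> parcs G" "distinct (tl (pawalk_verts u p))"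
      using p(1) unfolding cycle_def awalk_def by auto
    have arcs: "e1 \<in> parcs G" "e2 \<in> parcs G" "e3 \<in> parcs G" using u(2) es by auto
    have links: "fst e1 = u" "fst e2 = snd e1" "fst e3 = snd e2" using u(1) es by auto
    have verts: "pawalk_verts u p = u # map snd p"
      using awalk_verts_conv'[of u p u] u(1) es by simp
    have "distinct [snd e1, snd e2, snd e3]"
      using u(3) es unfolding verts by auto
    moreover have "last (map snd p) = u"
      using awlast_if_cas[of u p u] u(1) es unfolding cas_with_proj_eq awalk_verts_with_proj_eq verts
      by simp
    \<comment> \<open>The walk closes up at \<open>u\<close>, which therefore occurs among the heads
      from \<open>e3\<close> on. As the heads are distinct, \<open>u\<close> is not the head of
      \<open>e2\<close>.\<close>
    then have "u \<in> set (snd e3 # map snd es)" using es by (metis last_ConsR last_in_set list.distinct(1) list.map(2))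
    then have "snd e2 \<noteq> u"
      using u(3) es unfolding verts by auto
    moreover have "fst e1 = c \<or> snd e1 = c" "fst e2 = c \<or> snd e2 = c" "fst e3 = c \<or> snd e3 = c"
      using assms arcs by (metis prod.collapse)+
    ultimately show False using links by auto
  qed
  then have "\<infinity> \<le> girth G" by (intro girth_ge) blast
  then show ?thesis by simp
qed

end

section \<open>Finite lattices: bottom, top and zero meets\<close>

lemma finite_chain_imp_finite_lattice:
  assumes "finite_chain C"
  shows "finite_lattice C"
proof -
  interpret total_order C using assms by (simp add: finite_chain_def)
  have "lattice C" by unfold_locales
  with assms show ?thesis by (simp add: finite_lattice_def finite_chain_def)
qed

locale finite_lat = lattice L for L :: "'a gorder" (structure) +
  assumes finite_carrier: "finite (carrier L)"
    and carrier_nonempty: "carrier L \<noteq> {}"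
begin

sublocale weak_partial_order_bottom L
proof
  \<comment> \<open>In a finite lattice the whole carrier has an infimum, and this is the least
    element.\<close>
  from finite_inf_greatest[OF finite_carrier _ carrier_nonempty]
  have "greatest L (\<Sqinter>carrier L) (Lower L (carrier L))" by simp
  then show "\<exists>x. least L x (carrier L)"
    by (intro exI) (auto simp: least_def greatest_def Lower_def)
qed

sublocale weak_partial_order_top L
proof
  from finite_sup_least[OF finite_carrier _ carrier_nonempty]
  have "least L (\<Squnion>carrier L) (Upper L (carrier L))" by simp
  then show "\<exists>x. greatest L x (carrier L)"
    by (intro exI) (auto simp: least_def greatest_def Upper_def)
qed

lemma bottom_eqI: "x \<in> carrier L \<Longrightarrow> (\<And>y. y \<in> carrier L \<Longrightarrow> x \<sqsubseteq> y) \<Longrightarrow> \<bottom> = x"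
  by (rule le_antisym) auto

lemma top_eqI: "x \<in> carrier L \<Longrightarrow> (\<And>y. y \<in> carrier L \<Longrightarrow> y \<sqsubseteq> x) \<Longrightarrow> \<top> = x"
  by (rule le_antisym) auto

lemma le_bottom_iff: "x \<in> carrier L \<Longrightarrow> x \<sqsubseteq> \<bottom> \<longleftrightarrow> x = \<bottom>"
  using le_antisym by auto

lemma top_le_iff: "x \<in> carrier L \<Longrightarrow> \<top> \<sqsubseteq> x \<longleftrightarrow> x = \<top>"
  using le_antisym by auto

text \<open>Passing from the meet to common lower bounds leaves a statement about the order alone,
  to which a chain condition on upper sets applies.\<close>

lemma meet_eq_bottom_iff:
  assumes "x \<in> carrier L" "y \<in> carrier L"
  shows "x \<sqinter> y = \<bottom> \<longleftrightarrow> (\<forall>z\<in>carrier L. z \<sqsubseteq> x \<longrightarrow> z \<sqsubseteq> y \<longrightarrow> z = \<bottom>)"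
  using assms meet_left[of x y] meet_right[of x y] meet_le[of _ x y] meet_closed[of x y]
  by (metis le_bottom_iff)

end

lemma finite_lat_iff: "finite_lat L \<longleftrightarrow> finite_lattice L"
  by (auto simp: finite_lat_def finite_lat_axioms_def finite_lattice_def)

section \<open>Tree-like orders and atoms under the gluing of a chain\<close>

definition upset_chain :: "'a gorder \<Rightarrow> bool" where
  "upset_chain L \<longleftrightarrow> (\<forall>x\<in>carrier L. \<forall>y\<in>carrier L. \<forall>z\<in>carrier L.
     x \<noteq> \<bottom>\<^bsub>L\<^esub> \<longrightarrow> x \<sqsubseteq>\<^bsub>L\<^esub> y \<longrightarrow> x \<sqsubseteq>\<^bsub>L\<^esub> z \<longrightarrow> y \<sqsubseteq>\<^bsub>L\<^esub> z \<or> z \<sqsubseteq>\<^bsub>L\<^esub> y)"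

definition downset_chain :: "'a gorder \<Rightarrow> bool" where
  "downset_chain L \<longleftrightarrow> (\<forall>x\<in>carrier L. \<forall>y\<in>carrier L. \<forall>z\<in>carrier L.
     x \<noteq> \<top>\<^bsub>L\<^esub> \<longrightarrow> y \<sqsubseteq>\<^bsub>L\<^esub> x \<longrightarrow> z \<sqsubseteq>\<^bsub>L\<^esub> x \<longrightarrow> y \<sqsubseteq>\<^bsub>L\<^esub> z \<or> z \<sqsubseteq>\<^bsub>L\<^esub> y)"

definition atoms :: "'a gorder \<Rightarrow> 'a set" where
  "atoms L = {x \<in> carrier L. x \<noteq> \<bottom>\<^bsub>L\<^esub> \<and>
     (\<forall>y\<in>carrier L. y \<sqsubseteq>\<^bsub>L\<^esub> x \<longrightarrow> y = \<bottom>\<^bsub>L\<^esub> \<or> y = x)}"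

text \<open>The adjunct itself is also taken to be a finite lattice, so that its bottom, top and
  atoms can be compared with those of \<open>L1\<close>. The inductions over representations carry
  this as a premise.\<close>

locale adjunct_lat =
  L: finite_lat L + L1: finite_lat L1 + L2: finite_lat L2
  for L L1 L2 :: "'a gorder" +
  fixes a b
  assumes is_adjunct: "is_adjunct L L1 a b L2"
begin

lemma carrier_eq: "carrier L = carrier L1 \<union> carrier L2"
  and disjoint: "carrier L1 \<inter> carrier L2 = {}"
  and a_in [simp]: "a \<in> carrier L1" and b_in [simp]: "b \<in> carrier L1"
  and le_ab: "a \<sqsubseteq>\<^bsub>L1\<^esub> b" and a_neq_b: "a \<noteq> b"
  using is_adjunct
  by (auto simp: is_adjunct_def same_order_def adjunct_def L1.lless_eq)

lemma in_carrier [simp]: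
  "x \<in> carrier L1 \<Longrightarrow> x \<in> carrier L" "x \<in> carrier L2 \<Longrightarrow> x \<in> carrier L"
  by (simp_all add: carrier_eq)

text \<open>Since the carriers are disjoint, only one of the four disjuncts in
  \<open>adjunct\<close> can apply to a given pair of elements.\<close>

lemma le_11: "x \<in> carrier L1 \<Longrightarrow> y \<in> carrier L1 \<Longrightarrow> x \<sqsubseteq>\<^bsub>L\<^esub> y \<longleftrightarrow> x \<sqsubseteq>\<^bsub>L1\<^esub> y"
  and le_22: "x \<in> carrier L2 \<Longrightarrow> y \<in> carrier L2 \<Longrightarrow> x \<sqsubseteq>\<^bsub>L\<^esub> y \<longleftrightarrow> x \<sqsubseteq>\<^bsub>L2\<^esub> y"
  and le_12: "x \<in> carrier L1 \<Longrightarrow> y \<in> carrier L2 \<Longrightarrow> x \<sqsubseteq>\<^bsub>L\<^esub> y \<longleftrightarrow> x \<sqsubseteq>\<^bsub>L1\<^esub> a"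
  and le_21: "x \<in> carrier L2 \<Longrightarrow> y \<in> carrier L1 \<Longrightarrow> x \<sqsubseteq>\<^bsub>L\<^esub> y \<longleftrightarrow> b \<sqsubseteq>\<^bsub>L1\<^esub> y"
  using is_adjunct
  by (auto simp: is_adjunct_def same_order_def adjunct_def)

lemmas le_simps = le_11 le_22 le_12 le_21

text \<open>As \<open>b\<close> does not cover \<open>a\<close>, some element of \<open>L1\<close>
  lies strictly between them. It is incomparable with the whole glued part, so gluing really
  branches.\<close>

lemma middleE:
  obtains m where "m \<in> carrier L1" "a \<sqsubseteq>\<^bsub>L1\<^esub> m" "m \<sqsubseteq>\<^bsub>L1\<^esub> b" "m \<noteq> a" "m \<noteq> b"
  using is_adjunct
  by (auto simp: is_adjunct_def covered_by_def between_def L1.lless_eq)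

text \<open>The least element of \<open>L1\<close> is below \<open>a\<close> and hence below all of
  \<open>L2\<close>.\<close>

lemma bottom_eq: "\<bottom>\<^bsub>L\<^esub> = \<bottom>\<^bsub>L1\<^esub>"
  by (rule L.bottom_eqI) (auto simp: carrier_eq le_simps)

lemma top_eq: "\<top>\<^bsub>L\<^esub> = \<top>\<^bsub>L1\<^esub>"
  by (rule L.top_eqI) (auto simp: carrier_eq le_simps)

lemma in_L2_neq_bottom: "x \<in> carrier L2 \<Longrightarrow> x \<noteq> \<bottom>\<^bsub>L\<^esub>"
  using disjoint by (auto simp: bottom_eq)

text \<open>With \<open>a\<close> the least element, nothing in \<open>L2\<close> lies above a
  nonzero element of \<open>L1\<close>. Above an element of \<open>L2\<close> there are an upper
  part of the chain \<open>L2\<close> and the elements above \<open>b\<close>, which form a chain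
  because \<open>b\<close> is not zero.\<close>

lemma upset_chain_glue:
  assumes L1: "upset_chain L1" and L2: "total_order L2" and a: "a = \<bottom>\<^bsub>L\<^esub>"
  shows "upset_chain L"
proof -
  interpret L2: total_order L2 by fact
  have b: "b \<noteq> \<bottom>\<^bsub>L1\<^esub>" using a a_neq_b bottom_eq by simp
  have "y \<sqsubseteq>\<^bsub>L\<^esub> z \<or> z \<sqsubseteq>\<^bsub>L\<^esub> y"
    if *: "x \<in> carrier L" "y \<in> carrier L" "z \<in> carrier L" "x \<noteq> \<bottom>\<^bsub>L\<^esub>" "x \<sqsubseteq>\<^bsub>L\<^esub> y" "x \<sqsubseteq>\<^bsub>L\<^esub> z" for x y z
  proof (cases "x \<in> carrier L1")
    case True
    then have "y \<in> carrier L1" "z \<in> carrier L1"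
      using * a by (auto simp: carrier_eq le_simps bottom_eq L1.le_bottom_iff)
    then show ?thesis
      using * L1 True by (simp add: upset_chain_def le_simps bottom_eq)
  next
    case False
    then have x: "x \<in> carrier L2" using * by (simp add: carrier_eq)
    have above_b: "y \<sqsubseteq>\<^bsub>L1\<^esub> z \<or> z \<sqsubseteq>\<^bsub>L1\<^esub> y"
      if "y \<in> carrier L1" "z \<in> carrier L1" "b \<sqsubseteq>\<^bsub>L1\<^esub> y" "b \<sqsubseteq>\<^bsub>L1\<^esub> z"
      using L1 b that b_in unfolding upset_chain_def by blast
    have "y \<in> carrier L1 \<or> y \<in> carrier L2" "z \<in> carrier L1 \<or> z \<in> carrier L2"
      using * by (simp_all add: carrier_eq)
    then show ?thesis
      using *(5,6) x above_b L2.total_order_total[of y z] by (elim disjE) (simp_all add: le_simps)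
  qed
  then show ?thesis unfolding upset_chain_def by blast
qed

text \<open>Order dual of \<open>upset_chain_glue\<close>: with \<open>b\<close> the greatest
  element, nothing in \<open>L2\<close> lies below an element of \<open>L1\<close> other than the
  top.\<close>

lemma downset_chain_glue:
  assumes L1: "downset_chain L1" and L2: "total_order L2" and b: "b = \<top>\<^bsub>L\<^esub>"
  shows "downset_chain L"
proof -
  interpret L2: total_order L2 by fact
  have a: "a \<noteq> \<top>\<^bsub>L1\<^esub>" using b a_neq_b top_eq by simp
  have "y \<sqsubseteq>\<^bsub>L\<^esub> z \<or> z \<sqsubseteq>\<^bsub>L\<^esub> y"
    if *: "x \<in> carrier L" "y \<in> carrier L" "z \<in> carrier L" "x \<noteq> \<top>\<^bsub>L\<^esub>" "y \<sqsubseteq>\<^bsub>L\<^esub> x" "z \<sqsubseteq>\<^bsub>L\<^esub> x" for x y z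
  proof (cases "x \<in> carrier L1")
    case True
    then have "y \<in> carrier L1" "z \<in> carrier L1"
      using * b by (auto simp: carrier_eq le_simps top_eq L1.top_le_iff)
    then show ?thesis
      using * L1 True by (simp add: downset_chain_def le_simps top_eq)
  next
    case False
    then have x: "x \<in> carrier L2" using * by (simp add: carrier_eq)
    have below_a: "y \<sqsubseteq>\<^bsub>L1\<^esub> z \<or> z \<sqsubseteq>\<^bsub>L1\<^esub> y"
      if "y \<in> carrier L1" "z \<in> carrier L1" "y \<sqsubseteq>\<^bsub>L1\<^esub> a" "z \<sqsubseteq>\<^bsub>L1\<^esub> a"
      using L1 a that a_in unfolding downset_chain_def by blast
    have "y \<in> carrier L1 \<or> y \<in> carrier L2" "z \<in> carrier L1 \<or> z \<in> carrier L2"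
      using * by (simp_all add: carrier_eq)
    then show ?thesis
      using *(5,6) x below_a L2.total_order_total[of y z] by (elim disjE) (simp_all add: le_simps)
  qed
  then show ?thesis unfolding downset_chain_def by blast
qed

lemma upset_chain_left: "upset_chain L \<Longrightarrow> upset_chain L1"
  unfolding upset_chain_def bottom_eq by (simp add: le_11[symmetric]) (blast intro: in_carrier)

text \<open>If \<open>a\<close> were not zero, an element strictly between \<open>a\<close> and
  \<open>b\<close> and the least element of \<open>L2\<close> would both lie above \<open>a\<close>
  and have to be comparable, which puts the former below \<open>a\<close> or above \<open>b\<close>.
  So the chain condition on \<open>L\<close> forces every representation to be a lower one, not only
  a given one.\<close>

lemma upset_chain_imp_lower:
  assumes "upset_chain L"
  shows "a = \<bottom>\<^bsub>L\<^esub>"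
proof (rule ccontr)
  assume "a \<noteq> \<bottom>\<^bsub>L\<^esub>"
  obtain m where m: "m \<in> carrier L1" "a \<sqsubseteq>\<^bsub>L1\<^esub> m" "m \<sqsubseteq>\<^bsub>L1\<^esub> b" "m \<noteq> a" "m \<noteq> b"
    by (rule middleE)
  have "m \<sqsubseteq>\<^bsub>L\<^esub> \<bottom>\<^bsub>L2\<^esub> \<or> \<bottom>\<^bsub>L2\<^esub> \<sqsubseteq>\<^bsub>L\<^esub> m"
    using assms[unfolded upset_chain_def, rule_format, of a m "\<bottom>\<^bsub>L2\<^esub>"] \<open>a \<noteq> \<bottom>\<^bsub>L\<^esub>\<close> m
    by (simp add: le_simps)
  then have "m \<sqsubseteq>\<^bsub>L1\<^esub> a \<or> b \<sqsubseteq>\<^bsub>L1\<^esub> m" using m(1) by (simp add: le_simps)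
  then show False using m L1.le_antisym a_in b_in by blast
qed

text \<open>The least element of the glued part has only zero strictly below it and is a new atom;
  the rest of that part lies above it. Atoms of \<open>L1\<close> survive because elements of
  \<open>L2\<close> lie only below those elements of \<open>L1\<close> that are above
  \<open>b\<close>.\<close>

lemma atoms_glue:
  assumes a: "a = \<bottom>\<^bsub>L\<^esub>"
  shows "atoms L = insert \<bottom>\<^bsub>L2\<^esub> (atoms L1)"
proof (intro equalityI subsetI)
  fix x assume x: "x \<in> atoms L"
  show "x \<in> insert \<bottom>\<^bsub>L2\<^esub> (atoms L1)"
  proof (cases "x \<in> carrier L1")
    case True
    with x show ?thesis by (auto simp: atoms_def bottom_eq le_simps)
  next
    case False
    with x have x2: "x \<in> carrier L2" by (simp add: atoms_def carrier_eq)
    then have "\<bottom>\<^bsub>L2\<^esub> \<sqsubseteq>\<^bsub>L\<^esub> x" by (simp add: le_simps)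
    with x in_L2_neq_bottom[of "\<bottom>\<^bsub>L2\<^esub>"] have "\<bottom>\<^bsub>L2\<^esub> = x" by (auto simp: atoms_def)
    then show ?thesis by simp
  qed
next
  fix x assume "x \<in> insert \<bottom>\<^bsub>L2\<^esub> (atoms L1)"
  then show "x \<in> atoms L"
  proof
    assume "x = \<bottom>\<^bsub>L2\<^esub>"
    then show ?thesis
      using in_L2_neq_bottom a
      by (auto simp: atoms_def carrier_eq le_simps L2.le_bottom_iff L1.le_bottom_iff bottom_eq)
  next
    assume x: "x \<in> atoms L1"
    obtain m where m: "m \<in> carrier L1" "m \<sqsubseteq>\<^bsub>L1\<^esub> b" "m \<noteq> a" "m \<noteq> b" by (rule middleE)
    \<comment> \<open>An atom above \<open>b\<close> would be \<open>b\<close> itself, but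
      \<open>m\<close> is nonzero and strictly below \<open>b\<close>.\<close>
    have "\<not> b \<sqsubseteq>\<^bsub>L1\<^esub> x"
    proof
      assume "b \<sqsubseteq>\<^bsub>L1\<^esub> x"
      then have "b = x" using x a a_neq_b by (auto simp: atoms_def bottom_eq)
      with m x a show False by (auto simp: atoms_def bottom_eq)
    qed
    with x show ?thesis by (auto simp: atoms_def carrier_eq le_simps bottom_eq)
  qed
qed

end

section \<open>Chain conditions and the number of atoms, by induction over representations\<close>

lemma adjunct_latI:
  assumes "finite_lattice L" "is_adjunct L L1 a b L2"
  shows "adjunct_lat L L1 L2 a b"
  using assms by (auto simp: adjunct_lat_def adjunct_lat_axioms_def finite_lat_iff is_adjunct_def)

text \<open>Gluing keeps the least element, so the condition on the pairs means the same at every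
  stage of the construction.\<close>

lemma upset_chain_if_lower_rep:
  "adjunct_rep ps L \<Longrightarrow> finite_lattice L \<Longrightarrow> \<forall>p\<in>set ps. fst p = \<bottom>\<^bsub>L\<^esub> \<Longrightarrow> upset_chain L"
proof (induction rule: adjunct_rep.induct)
  case (chain C)
  then interpret total_order C by (simp add: finite_chain_def)
  show ?case by (auto simp: upset_chain_def total_order_total)
next
  case (glue ps L1 C L a b)
  then interpret adjunct_lat L L1 C a b by (intro adjunct_latI)
  from glue show ?case
    by (intro upset_chain_glue) (auto simp: finite_chain_def is_adjunct_def bottom_eq)
qed

lemma downset_chain_if_upper_rep:
  "adjunct_rep ps L \<Longrightarrow> finite_lattice L \<Longrightarrow> \<forall>p\<in>set ps. snd p = \<top>\<^bsub>L\<^esub> \<Longrightarrow> downset_chain L"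
proof (induction rule: adjunct_rep.induct)
  case (chain C)
  then interpret total_order C by (simp add: finite_chain_def)
  show ?case by (auto simp: downset_chain_def total_order_total)
next
  case (glue ps L1 C L a b)
  then interpret adjunct_lat L L1 C a b by (intro adjunct_latI)
  from glue show ?case
    by (intro downset_chain_glue) (auto simp: finite_chain_def is_adjunct_def top_eq)
qed

context finite_lat
begin

lemma finite_atoms: "finite (atoms L)"
  using finite_carrier by (simp add: atoms_def)

text \<open>Descending to smaller nonzero elements ends in an atom, because the number of elements
  below strictly drops.\<close>

lemma atom_below:
  assumes "x \<in> carrier L" "x \<noteq> \<bottom>"
  obtains p where "p \<in> atoms L" "p \<sqsubseteq> x"
proof -
  have "\<exists>p. p \<in> atoms L \<and> p \<sqsubseteq> x"
    using assms
  proof (induction "card {y \<in> carrier L. y \<sqsubseteq> x}" arbitrary: x rule: less_induct)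
    case less
    show ?case
    proof (cases "x \<in> atoms L")
      case True
      with less.prems show ?thesis by blast
    next
      case False
      then obtain y where y: "y \<in> carrier L" "y \<sqsubseteq> x" "y \<noteq> \<bottom>" "y \<noteq> x"
        using less.prems by (auto simp: atoms_def)
      have "{z \<in> carrier L. z \<sqsubseteq> y} \<subset> {z \<in> carrier L. z \<sqsubseteq> x}"
        using y less.prems by (auto intro: le_trans)
      then have "card {z \<in> carrier L. z \<sqsubseteq> y} < card {z \<in> carrier L. z \<sqsubseteq> x}"
        using finite_carrier by (intro psubset_card_mono) auto
      with less.hyps y obtain p where "p \<in> atoms L" "p \<sqsubseteq> y" by blast
      moreover from this have "p \<in> carrier L" by (simp add: atoms_def)
      ultimately show ?thesis using y less.prems le_trans by blast
    qed
  qed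
  with that show thesis by blast
qed

lemma atoms_le_eq: "p \<in> atoms L \<Longrightarrow> q \<in> atoms L \<Longrightarrow> p \<sqsubseteq> q \<Longrightarrow> p = q"
  by (auto simp: atoms_def)

end

text \<open>A one-element chain has no atom, hence the requirement that bottom and top
  differ.\<close>

lemma card_atoms_chain:
  assumes "finite_chain C" "\<bottom>\<^bsub>C\<^esub> \<noteq> \<top>\<^bsub>C\<^esub>"
  shows "card (atoms C) = 1"
proof -
  interpret finite_lat C using assms by (simp add: finite_chain_imp_finite_lattice finite_lat_iff)
  interpret total_order C using assms by (simp add: finite_chain_def)
  obtain p where p: "p \<in> atoms C" using atom_below[of "\<top>\<^bsub>C\<^esub>"] assms(2) by auto
  have "q = p" if "q \<in> atoms C" for q
  proof -
    have "p \<sqsubseteq>\<^bsub>C\<^esub> q \<or> q \<sqsubseteq>\<^bsub>C\<^esub> p"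
      using p that by (intro total_order_total) (simp_all add: atoms_def)
    with p that atoms_le_eq show ?thesis by blast
  qed
  with p have "atoms C = {p}" by blast
  then show ?thesis by simp
qed

text \<open>The chain condition is imposed on \<open>L\<close> and not on \<open>ps\<close>, so the
  count holds for every representation and fixes the number of chains. The condition passes down to
  \<open>L1\<close>, and each gluing adds one atom.\<close>

lemma card_atoms_eq:
  "adjunct_rep ps L \<Longrightarrow> finite_lattice L \<Longrightarrow> upset_chain L \<Longrightarrow> \<bottom>\<^bsub>L\<^esub> \<noteq> \<top>\<^bsub>L\<^esub> \<Longrightarrow>
    card (atoms L) = length ps + 1"
proof (induction rule: adjunct_rep.induct)
  case (chain C)
  then show ?case by (simp add: card_atoms_chain)
next
  case (glue ps L1 C L a b)
  then interpret adjunct_lat L L1 C a b by (intro adjunct_latI)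
  have "card (atoms L1) = length ps + 1"
    using glue upset_chain_left by (auto simp: is_adjunct_def bottom_eq top_eq)
  moreover have "\<bottom>\<^bsub>C\<^esub> \<notin> atoms L1" using disjoint by (auto simp: atoms_def)
  ultimately show ?case
    using atoms_glue[OF upset_chain_imp_lower] glue L1.finite_atoms by simp
qed

lemma bottom_neq_top_if_glued:
  assumes "adjunct_rep ps L" "finite_lattice L" "ps \<noteq> []"
  shows "\<bottom>\<^bsub>L\<^esub> \<noteq> \<top>\<^bsub>L\<^esub>"
  using assms
proof (cases rule: adjunct_rep.cases)
  case (glue ps L1 C a b)
  then interpret adjunct_lat L L1 C a b using assms by (intro adjunct_latI)
  show ?thesis
  proof
    assume "\<bottom>\<^bsub>L\<^esub> = \<top>\<^bsub>L\<^esub>"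
    then have "x = \<bottom>\<^bsub>L\<^esub>" if "x \<in> carrier L" for x
      using that L.le_bottom_iff[of x] L.top_higher[of x] by simp
    then show False using a_neq_b a_in b_in in_carrier(1) by metis
  qed
qed simp

section \<open>The zero-divisor graph of a tree-like lattice\<close>

lemma pair_wf_digraph_zero_divisor_graph: "pair_wf_digraph (zero_divisor_graph L)"
  by unfold_locales (auto simp: zero_divisor_graph_def)

locale up_tree = finite_lat +
  assumes upset_chain: "upset_chain L"
begin

abbreviation "G \<equiv> zero_divisor_graph L"

sublocale G: pair_wf_digraph G
  by (rule pair_wf_digraph_zero_divisor_graph)

lemma comparable_if_common_lower:
  "x \<in> carrier L \<Longrightarrow> y \<in> carrier L \<Longrightarrow> z \<in> carrier L \<Longrightarrow> x \<noteq> \<bottom> \<Longrightarrow> x \<sqsubseteq> y \<Longrightarrow> x \<sqsubseteq> z \<Longrightarrow>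
    y \<sqsubseteq> z \<or> z \<sqsubseteq> y"
  using upset_chain unfolding upset_chain_def by blast

lemma meet_bottom_iff_incomparable:
  assumes "x \<in> carrier L" "y \<in> carrier L" "x \<noteq> \<bottom>" "y \<noteq> \<bottom>"
  shows "x \<sqinter> y = \<bottom> \<longleftrightarrow> \<not> x \<sqsubseteq> y \<and> \<not> y \<sqsubseteq> x"
  unfolding meet_eq_bottom_iff[OF assms(1,2)]
  using assms comparable_if_common_lower[of _ x y] le_refl by blast

lemma arc_iff:
  "(x, y) \<in> parcs G \<longleftrightarrow>
    x \<in> carrier L \<and> y \<in> carrier L \<and> x \<noteq> \<bottom> \<and> y \<noteq> \<bottom> \<and> \<not> x \<sqsubseteq> y \<and> \<not> y \<sqsubseteq> x"
proof
  assume "(x, y) \<in> parcs G"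
  then show "x \<in> carrier L \<and> y \<in> carrier L \<and> x \<noteq> \<bottom> \<and> y \<noteq> \<bottom> \<and> \<not> x \<sqsubseteq> y \<and> \<not> y \<sqsubseteq> x"
    using meet_bottom_iff_incomparable[of x y]
    by (simp add: zero_divisor_graph_def zero_divisors_def)
next
  assume *: "x \<in> carrier L \<and> y \<in> carrier L \<and> x \<noteq> \<bottom> \<and> y \<noteq> \<bottom> \<and> \<not> x \<sqsubseteq> y \<and> \<not> y \<sqsubseteq> x"
  then have meet: "x \<sqinter> y = \<bottom>" "y \<sqinter> x = \<bottom>"
    using meet_bottom_iff_incomparable[of x y] meet_bottom_iff_incomparable[of y x] by simp_all
  have "x \<in> zero_divisors L" "y \<in> zero_divisors L"
    using * meet unfolding zero_divisors_def by blast+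
  moreover have "x \<noteq> y" using * le_refl by blast
  ultimately show "(x, y) \<in> parcs G"
    using meet by (simp add: zero_divisor_graph_def)
qed

lemma arc_sym: "(x, y) \<in> parcs G \<Longrightarrow> (y, x) \<in> parcs G"
  by (simp add: arc_iff)

lemma vert_nonbottom: "x \<in> pverts G \<Longrightarrow> x \<in> carrier L \<and> x \<noteq> \<bottom>"
  by (simp add: zero_divisor_graph_def zero_divisors_def)

lemma vert_iff: "x \<in> pverts G \<longleftrightarrow> (\<exists>y. (x, y) \<in> parcs G)"
proof
  assume x: "x \<in> pverts G"
  then obtain y where y: "y \<in> carrier L" "y \<noteq> \<bottom>" "x \<sqinter> y = \<bottom>"
    by (auto simp: zero_divisor_graph_def zero_divisors_def)
  have "(x, y) \<in> parcs G"
    using vert_nonbottom[OF x] y meet_bottom_iff_incomparable[of x y] by (simp add: arc_iff)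
  then show "\<exists>y. (x, y) \<in> parcs G" ..
next
  assume "\<exists>y. (x, y) \<in> parcs G"
  then show "x \<in> pverts G" by (auto simp: zero_divisor_graph_def)
qed

lemma top_not_vert: "\<top> \<notin> pverts G"
  by (simp add: vert_iff arc_iff)

lemma atoms_arc: "p \<in> atoms L \<Longrightarrow> q \<in> atoms L \<Longrightarrow> p \<noteq> q \<Longrightarrow> (p, q) \<in> parcs G"
  unfolding arc_iff using atoms_le_eq[of p q] atoms_le_eq[of q p] by (auto simp: atoms_def)

text \<open>If \<open>u\<close> were below \<open>w\<close>, then \<open>v\<close> and
  \<open>w\<close> would be comparable, as both lie above the nonzero \<open>u\<close>; if
  \<open>w\<close> were below \<open>u\<close>, it would be below \<open>v\<close>.\<close>

lemma arc_down:
  assumes "(v, w) \<in> parcs G" "u \<in> carrier L" "u \<noteq> \<bottom>" "u \<sqsubseteq> v"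
  shows "(u, w) \<in> parcs G"
proof -
  have "\<not> u \<sqsubseteq> w" using assms comparable_if_common_lower[of u v w] by (auto simp: arc_iff)
  moreover have "\<not> w \<sqsubseteq> u" using assms le_trans[of w u v] by (auto simp: arc_iff)
  ultimately show ?thesis using assms by (simp add: arc_iff)
qed

text \<open>Comparable vertices have a common neighbour: by \<open>arc_down\<close> any neighbour of
  the larger one is a neighbour of the smaller one.\<close>

lemma diam_le_2: "graph_diam G \<le> 2"
proof (rule G.graph_diam_le)
  fix u v assume uv: "u \<in> pverts G" "v \<in> pverts G"
  note nb = vert_nonbottom[OF uv(1)] vert_nonbottom[OF uv(2)]
  consider "(u, v) \<in> parcs G" | "u \<sqsubseteq> v" | "v \<sqsubseteq> u"
    using nb by (auto simp: arc_iff)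
  then show "graph_dist G u v \<le> 2"
  proof cases
    case 1
    then show ?thesis using G.graph_dist_arc[of u v] order_trans[of _ "1::ereal" 2] by simp
  next
    case 2
    from uv(2) obtain w where "(v, w) \<in> parcs G" by (auto simp: vert_iff)
    with 2 nb show ?thesis using arc_down arc_sym by (intro G.graph_dist_arc2[of u w v]) blast+
  next
    case 3
    from uv(1) obtain w where "(u, w) \<in> parcs G" by (auto simp: vert_iff)
    with 3 nb show ?thesis using arc_down arc_sym by (intro G.graph_dist_arc2[of u w v]) blast+
  qed
qed

lemma two_atomsE:
  assumes "2 \<le> card (atoms L)"
  obtains p q where "p \<in> atoms L" "q \<in> atoms L" "p \<noteq> q"
  using assms by (auto simp: card_le_Suc_iff numeral_2_eq_2)

lemma atoms_subset_verts: "2 \<le> card (atoms L) \<Longrightarrow> atoms L \<subseteq> pverts G"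
  by (metis atoms_arc subsetI two_atomsE vert_iff)

lemma girth_eq_3_iff: "girth G = 3 \<longleftrightarrow> 3 \<le> card (atoms L)"
proof
  assume "3 \<le> card (atoms L)"
  then obtain p q r where "p \<in> atoms L" "q \<in> atoms L" "r \<in> atoms L" "distinct [p, q, r]"
    by (auto simp: card_le_Suc_iff numeral_3_eq_3)
  then have "girth G \<le> 3" by (intro G.girth_le_3[of p q r]) (auto intro: atoms_arc)
  with G.girth_ge_3 show "girth G = 3" by (rule antisym[rotated])
next
  assume girth: "girth G = 3"
  \<comment> \<open>A graph without triangles has girth at least 4, so girth 3 yields a
    triangle.\<close>
  have "\<not> (4::enat) \<le> 3" by simp
  then obtain x y z where arcs: "(x, y) \<in> parcs G" "(y, z) \<in> parcs G" "(z, x) \<in> parcs G"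
    using G.girth_ge_4 girth by metis
  then have "x \<in> carrier L \<and> x \<noteq> \<bottom>" "y \<in> carrier L \<and> y \<noteq> \<bottom>" "z \<in> carrier L \<and> z \<noteq> \<bottom>"
    by (simp_all add: arc_iff)
  then obtain p q r where pqr: "p \<in> atoms L" "q \<in> atoms L" "r \<in> atoms L" "p \<sqsubseteq> x" "q \<sqsubseteq> y" "r \<sqsubseteq> z"
    by (meson atom_below)
  \<comment> \<open>An atom below both ends of an arc would make them comparable.\<close>
  have neq: "p' \<noteq> q'" if "(u, v) \<in> parcs G" "p' \<in> atoms L" "p' \<sqsubseteq> u" "q' \<sqsubseteq> v" for u v p' q'
    using comparable_if_common_lower[of p' u v] that by (auto simp: arc_iff atoms_def)
  have "p \<noteq> q" "q \<noteq> r" "r \<noteq> p" using neq arcs pqr by blast+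
  then have "card {p, q, r} = 3" by simp
  moreover have "card {p, q, r} \<le> card (atoms L)"
    using pqr finite_atoms by (intro card_mono) auto
  ultimately show "3 \<le> card (atoms L)" by simp
qed

lemma complete_if_flat:
  assumes flat: "\<And>x y. x \<in> carrier L \<Longrightarrow> y \<in> carrier L \<Longrightarrow> x \<sqsubseteq> y \<Longrightarrow> x = \<bottom> \<or> y = \<top> \<or> x = y"
    and "u \<in> pverts G" "v \<in> pverts G" "u \<noteq> v"
  shows "(u, v) \<in> parcs G"
  using flat[of u v] flat[of v u] assms(2-4) top_not_vert vert_nonbottom[of u] vert_nonbottom[of v]
  by (auto simp: arc_iff)

text \<open>Two distinct atoms cannot both lie below \<open>x\<close>, since elements below
  \<open>x\<close> are comparable and comparable atoms are equal. An atom that is not below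
  \<open>x\<close> is incomparable with \<open>x\<close>.\<close>

lemma vert_if_downset_chain:
  assumes "downset_chain L" "2 \<le> card (atoms L)" "x \<in> carrier L" "x \<noteq> \<bottom>" "x \<noteq> \<top>"
  shows "x \<in> pverts G"
proof -
  obtain p q where pq: "p \<in> atoms L" "q \<in> atoms L" "p \<noteq> q" using assms(2) by (rule two_atomsE)
  then have c: "p \<in> carrier L" "q \<in> carrier L" by (simp_all add: atoms_def)
  have "\<not> (p \<sqsubseteq> x \<and> q \<sqsubseteq> x)"
    using assms(1,3,5) pq c atoms_le_eq unfolding downset_chain_def by metis
  then obtain r where r: "r \<in> atoms L" "\<not> r \<sqsubseteq> x" using pq by blast
  then have "\<not> x \<sqsubseteq> r" using assms(3,4) le_refl by (auto simp: atoms_def)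
  with r assms show ?thesis by (auto simp: vert_iff arc_iff atoms_def)
qed

end

section \<open>Diameter 1 and the lattices \<open>M_lat n\<close>\<close>

lemma flat_if_order_iso_M_lat:
  assumes "finite_lattice L" "order_iso L (M_lat n)" "x \<in> carrier L" "y \<in> carrier L" "x \<sqsubseteq>\<^bsub>L\<^esub> y"
  shows "x = \<bottom>\<^bsub>L\<^esub> \<or> y = \<top>\<^bsub>L\<^esub> \<or> x = y"
proof -
  interpret finite_lat L using assms(1) by (simp add: finite_lat_iff)
  obtain f where f: "order_emb L (M_lat n) f" "bij_betw f (carrier L) (carrier (M_lat n))"
    using assms by (auto simp: order_iso_def)
  have le: "u \<sqsubseteq>\<^bsub>L\<^esub> v \<longleftrightarrow> f u = M_zero \<or> f v = M_one \<or> f u = f v"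
    if "u \<in> carrier L" "v \<in> carrier L" for u v
    using f(1) that by (simp add: order_emb_def M_lat_def)
  have "f x = M_zero \<or> f y = M_one \<or> f x = f y" using le assms by blast
  then show ?thesis
  proof (elim disjE)
    assume "f x = M_zero"
    then have "\<bottom>\<^bsub>L\<^esub> = x" using le assms by (intro bottom_eqI) auto
    then show ?thesis by simp
  next
    assume "f y = M_one"
    then have "\<top>\<^bsub>L\<^esub> = y" using le assms by (intro top_eqI) auto
    then show ?thesis by simp
  next
    assume "f x = f y"
    then show ?thesis using f(2) assms by (auto simp: bij_betw_def inj_on_def)
  qed
qed

text \<open>The middle elements of a flat order are pairwise incomparable, so any numbering of them
  gives an isomorphism.\<close>

lemma order_iso_M_lat_if_flat:
  assumes "finite_lattice L" "\<bottom>\<^bsub>L\<^esub> \<noteq> \<top>\<^bsub>L\<^esub>" "card (carrier L - {\<bottom>\<^bsub>L\<^esub>, \<top>\<^bsub>L\<^esub>}) = n"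
    and flat: "\<And>x y. x \<in> carrier L \<Longrightarrow> y \<in> carrier L \<Longrightarrow> x \<sqsubseteq>\<^bsub>L\<^esub> y \<Longrightarrow> x = \<bottom>\<^bsub>L\<^esub> \<or> y = \<top>\<^bsub>L\<^esub> \<or> x = y"
  shows "order_iso L (M_lat n)"
proof -
  interpret finite_lat L using assms(1) by (simp add: finite_lat_iff)
  let ?A = "carrier L - {\<bottom>\<^bsub>L\<^esub>, \<top>\<^bsub>L\<^esub>}"
  have fin: "finite ?A" using finite_carrier by (rule finite_Diff)
  have "card ?A = card {1..n}" unfolding assms(3) by simp
  from finite_same_card_bij[OF fin finite_atLeastAtMost this]
  obtain g where g: "bij_betw g ?A {1..n}" ..
  define f where "f x = (if x = \<bottom>\<^bsub>L\<^esub> then M_zero else if x = \<top>\<^bsub>L\<^esub> then M_one else M_atom (g x))" for x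
  have "inj_on f (carrier L)"
  proof (rule inj_onI)
    fix x y assume "x \<in> carrier L" "y \<in> carrier L" "f x = f y"
    then show "x = y"
      using bij_betw_imp_inj_on[OF g, THEN inj_onD, of x y] by (simp add: f_def split: if_splits)
  qed
  moreover have "f ` carrier L = carrier (M_lat n)"
  proof -
    have "carrier L = {\<bottom>\<^bsub>L\<^esub>, \<top>\<^bsub>L\<^esub>} \<union> ?A" by auto
    then have "f ` carrier L = {f \<bottom>\<^bsub>L\<^esub>, f \<top>\<^bsub>L\<^esub>} \<union> f ` ?A" by (metis image_Un image_insert image_empty)
    also have "f ` ?A = M_atom ` g ` ?A" by (auto simp: f_def image_image)
    also have "g ` ?A = {1..n}" using g by (simp add: bij_betw_def)
    finally show ?thesis using assms(2) by (simp add: f_def M_lat_def)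
  qed
  ultimately have bij: "bij_betw f (carrier L) (carrier (M_lat n))" by (simp add: bij_betw_def)
  have zero: "f x = M_zero \<longleftrightarrow> x = \<bottom>\<^bsub>L\<^esub>" and one: "f x = M_one \<longleftrightarrow> x = \<top>\<^bsub>L\<^esub>" for x
    using assms(2) by (auto simp: f_def)
  have "x \<sqsubseteq>\<^bsub>L\<^esub> y \<longleftrightarrow> f x \<sqsubseteq>\<^bsub>M_lat n\<^esub> f y" if xy: "x \<in> carrier L" "y \<in> carrier L" for x y
  proof -
    have "f x \<sqsubseteq>\<^bsub>M_lat n\<^esub> f y \<longleftrightarrow> x = \<bottom>\<^bsub>L\<^esub> \<or> y = \<top>\<^bsub>L\<^esub> \<or> x = y"
      using zero one xy \<open>inj_on f (carrier L)\<close> by (simp add: M_lat_def inj_on_eq_iff)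
    then show ?thesis using flat[OF xy] xy by auto
  qed
  moreover have "weak_partial_order (M_lat n)"
    by unfold_locales (auto simp: M_lat_def)
  ultimately show ?thesis
    using bij weak_partial_order_axioms unfolding order_iso_def order_emb_def by blast
qed

context up_tree
begin

text \<open>Diameter 1 means that distinct vertices are never comparable. Since every element other
  than the two ends is a vertex, the order is then flat.\<close>

lemma diam_eq_1_iff:
  assumes "downset_chain L" and card: "2 \<le> card (atoms L)"
  shows "graph_diam G = 1 \<longleftrightarrow> order_iso L (M_lat (card (atoms L)))"
proof -
  have fl: "finite_lattice L" using finite_lat_axioms by (simp add: finite_lat_iff)
  obtain p q where pq: "p \<in> atoms L" "q \<in> atoms L" "p \<noteq> q" using card by (rule two_atomsE)
  then have verts: "p \<in> pverts G" "q \<in> pverts G" using atoms_subset_verts card by auto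
  have diam: "graph_diam G = 1 \<longleftrightarrow>
      (\<forall>u\<in>pverts G. \<forall>v\<in>pverts G. u \<noteq> v \<longrightarrow> (u, v) \<in> parcs G)"
    using verts pq(3) by (rule G.graph_diam_eq_1_iff)
  show ?thesis
  proof
    assume "order_iso L (M_lat (card (atoms L)))"
    then show "graph_diam G = 1"
      unfolding diam using complete_if_flat flat_if_order_iso_M_lat[OF fl] by blast
  next
    assume "graph_diam G = 1"
    then have complete: "(u, v) \<in> parcs G" if "u \<in> pverts G" "v \<in> pverts G" "u \<noteq> v" for u v
      using diam that by blast
    have flat: "x = \<bottom> \<or> y = \<top> \<or> x = y" if xy: "x \<in> carrier L" "y \<in> carrier L" "x \<sqsubseteq> y" for x y
    proof (rule ccontr)
      assume neg: "\<not> ?thesis"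
      then have "x \<noteq> \<top>" "y \<noteq> \<bottom>" using xy top_le_iff le_bottom_iff by auto
      with neg have "x \<in> pverts G" "y \<in> pverts G"
        using xy vert_if_downset_chain[OF assms] by auto
      with complete neg xy show False by (auto simp: arc_iff)
    qed
    \<comment> \<open>Atoms are vertices and the top is not. So the atoms are exactly the middle
      elements, and their number is the parameter of \<open>M_lat\<close>.\<close>
    have "\<top> \<notin> atoms L" using atoms_subset_verts[OF card] top_not_vert by blast
    then have atoms: "atoms L = carrier L - {\<bottom>, \<top>}" 
      using flat by (auto simp: atoms_def)
    have "\<bottom> \<noteq> \<top>"
      using verts vert_nonbottom[of p] top_higher[of p] le_bottom_iff[of p] by auto
    then show "order_iso L (M_lat (card (atoms L)))"
      using flat atoms by (intro order_iso_M_lat_if_flat[OF fl]) auto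
  qed
qed

end

section \<open>Adjuncts of two chains and the exchange of their strands\<close>

definition suborder :: "'a gorder \<Rightarrow> 'a set \<Rightarrow> 'a gorder" where
  "suborder L S = \<lparr>carrier = S, eq = (=), le = le L\<rparr>"

lemma suborder_simps [simp]:
  "carrier (suborder L S) = S" "eq (suborder L S) = (=)" "le (suborder L S) = le L"
  by (simp_all add: suborder_def)

lemma (in finite_lat) finite_chain_suborder:
  assumes "S \<subseteq> carrier L" "S \<noteq> {}" "\<And>x y. x \<in> S \<Longrightarrow> y \<in> S \<Longrightarrow> x \<sqsubseteq> y \<or> y \<sqsubseteq> x"
  shows "finite_chain (suborder L S)"
proof -
  have "partial_order (suborder L S)"
  proof
    show "x \<sqsubseteq>\<^bsub>suborder L S\<^esub> z" if "x \<sqsubseteq>\<^bsub>suborder L S\<^esub> y" "y \<sqsubseteq>\<^bsub>suborder L S\<^esub> z"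
      "x \<in> carrier (suborder L S)" "y \<in> carrier (suborder L S)" "z \<in> carrier (suborder L S)" for x y z
      using that assms(1) le_trans[of x y z] by (simp add: subset_eq)
    show "x .=\<^bsub>suborder L S\<^esub> y" if "x \<sqsubseteq>\<^bsub>suborder L S\<^esub> y" "y \<sqsubseteq>\<^bsub>suborder L S\<^esub> x"
      "x \<in> carrier (suborder L S)" "y \<in> carrier (suborder L S)" for x y
      using that assms(1) le_antisym[of x y] by (simp add: subset_eq)
  qed (use assms(1) in \<open>auto simp: subset_eq\<close>)
  then have "total_order (suborder L S)"
    using assms(3) by (intro partial_order.total_orderI) simp_all
  then show ?thesis
    using assms(1,2) finite_carrier by (simp add: finite_chain_def finite_subset)
qed

locale adjunct_two_chains = adjunct_lat L C1 C2 a b for L C1 C2 :: "'a gorder" and a b +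
  assumes chain1: "finite_chain C1" and chain2: "finite_chain C2" and lower: "a = \<bottom>\<^bsub>L\<^esub>"
begin

lemma total1: "x \<in> carrier C1 \<Longrightarrow> y \<in> carrier C1 \<Longrightarrow> x \<sqsubseteq>\<^bsub>C1\<^esub> y \<or> y \<sqsubseteq>\<^bsub>C1\<^esub> x"
  using chain1 total_order.total_order_total[of C1 x y] by (simp add: finite_chain_def)

lemma total2: "x \<in> carrier C2 \<Longrightarrow> y \<in> carrier C2 \<Longrightarrow> x \<sqsubseteq>\<^bsub>C2\<^esub> y \<or> y \<sqsubseteq>\<^bsub>C2\<^esub> x"
  using chain2 total_order.total_order_total[of C2 x y] by (simp add: finite_chain_def)

text \<open>The strand of \<open>C1\<close> that runs parallel to \<open>C2\<close>.\<close>

abbreviation "B \<equiv> between C1 a b"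

lemma mem_B_iff: "x \<in> B \<longleftrightarrow> x \<in> carrier C1 \<and> x \<noteq> \<bottom>\<^bsub>L\<^esub> \<and> \<not> b \<sqsubseteq>\<^bsub>C1\<^esub> x"
  using total1[of x b] L1.le_antisym[of x b] L1.le_refl[of b]
  by (auto simp: between_def L1.lless_eq lower bottom_eq)

lemma le_a_iff: "x \<in> carrier C1 \<Longrightarrow> x \<sqsubseteq>\<^bsub>C1\<^esub> a \<longleftrightarrow> x = \<bottom>\<^bsub>L\<^esub>"
  by (simp add: lower bottom_eq L1.le_bottom_iff)

lemma le_B_2: "x \<in> B \<Longrightarrow> y \<in> carrier C2 \<Longrightarrow> \<not> x \<sqsubseteq>\<^bsub>L\<^esub> y"
  and le_2_B: "x \<in> B \<Longrightarrow> y \<in> carrier C2 \<Longrightarrow> \<not> y \<sqsubseteq>\<^bsub>L\<^esub> x"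
  by (auto simp: mem_B_iff le_simps le_a_iff)

lemma adjunct_rep: "adjunct_rep [(a, b)] L"
  using adjunct_rep.glue[OF adjunct_rep.chain[OF chain1] chain2 is_adjunct] by simp

lemma upset_chain: "upset_chain L"
  using adjunct_rep L.finite_lat_axioms lower
  by (intro upset_chain_if_lower_rep[of "[(a, b)]"]) (simp_all add: finite_lat_iff)

sublocale up_tree L
  by unfold_locales (rule upset_chain)

lemma card_atoms: "card (atoms L) = 2"
proof -
  have "finite_lattice L" using L.finite_lat_axioms by (simp add: finite_lat_iff)
  then show ?thesis
    using card_atoms_eq[OF adjunct_rep _ upset_chain] bottom_neq_top_if_glued[OF adjunct_rep] by simp
qed

text \<open>An element of \<open>C1\<close> outside \<open>B\<close> is zero or lies above
  \<open>b\<close>, hence is comparable with everything. The strands are chains, so arcs run only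
  between \<open>B\<close> and \<open>C2\<close>.\<close>

lemma arc_bipartite: "(x, y) \<in> parcs G \<longleftrightarrow> x \<in> B \<and> y \<in> carrier C2 \<or> x \<in> carrier C2 \<and> y \<in> B"
proof
  assume "(x, y) \<in> parcs G"
  then have xy: "x \<in> carrier L" "y \<in> carrier L" "x \<noteq> \<bottom>\<^bsub>L\<^esub>" "y \<noteq> \<bottom>\<^bsub>L\<^esub>" "\<not> x \<sqsubseteq>\<^bsub>L\<^esub> y" "\<not> y \<sqsubseteq>\<^bsub>L\<^esub> x"
    by (simp_all add: arc_iff)
  have "x \<in> carrier C1 \<or> x \<in> carrier C2" "y \<in> carrier C1 \<or> y \<in> carrier C2"
    using xy(1,2) by (simp_all add: carrier_eq)
  then show "x \<in> B \<and> y \<in> carrier C2 \<or> x \<in> carrier C2 \<and> y \<in> B"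
    using xy(3-6) total1[of x y] total2[of x y]
    by (elim disjE) (simp_all add: mem_B_iff le_simps)
next
  assume "x \<in> B \<and> y \<in> carrier C2 \<or> x \<in> carrier C2 \<and> y \<in> B"
  then show "(x, y) \<in> parcs G"
  proof (elim disjE conjE)
    assume "x \<in> B" "y \<in> carrier C2"
    then show ?thesis
      using le_B_2[of x y] le_2_B[of x y] in_L2_neq_bottom[of y] by (simp add: arc_iff mem_B_iff)
  next
    assume "x \<in> carrier C2" "y \<in> B"
    then show ?thesis
      using le_B_2[of y x] le_2_B[of y x] in_L2_neq_bottom[of x] by (simp add: arc_iff mem_B_iff)
  qed
qed

lemma B_nonempty: "B \<noteq> {}"
  using is_adjunct by (auto simp: is_adjunct_def covered_by_def)

text \<open>When \<open>C2\<close> is a single point, the complete bipartite graph is a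
  star.\<close>

lemma girth_infinity:
  assumes "card (carrier C2) = 1"
  shows "girth G = \<infinity>"
proof -
  obtain c where "carrier C2 = {c}" using assms by (auto simp: card_1_singleton_iff)
  then show ?thesis by (intro G.girth_star[of c]) (auto simp: arc_bipartite)
qed

text \<open>Two elements from each strand alternate in a 4-cycle. A triangle would need three atoms,
  and there are only two.\<close>

lemma girth_4:
  assumes "2 \<le> card (carrier C2)" "2 \<le> card B"
  shows "girth G = 4"
proof (rule antisym)
  have ex2: "\<exists>u v. u \<in> S \<and> v \<in> S \<and> u \<noteq> v" if "2 \<le> card S" for S :: "'a set"
    using that by (auto simp: card_le_Suc_iff numeral_2_eq_2)
  obtain c c' where c: "c \<in> carrier C2" "c' \<in> carrier C2" "c \<noteq> c'" using ex2 assms(1) by blast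
  obtain d d' where d: "d \<in> B" "d' \<in> B" "d \<noteq> d'" using ex2 assms(2) by blast
  have "c \<notin> B" "c' \<notin> B" using c disjoint by (auto simp: mem_B_iff)
  with c d have "distinct [c, d, c', d']" by auto
  with c d show "girth G \<le> 4" by (intro G.girth_le_4[of c d c' d']) (simp_all add: arc_bipartite)
  show "4 \<le> girth G"
  proof (rule G.girth_ge_4)
    fix x y z assume "(x, y) \<in> parcs G" "(y, z) \<in> parcs G" "(z, x) \<in> parcs G" "distinct [x, y, z]"
    then have "girth G \<le> 3" by (rule G.girth_le_3)
    then have "girth G = 3" using G.girth_ge_3 by (rule antisym)
    then show False using girth_eq_3_iff card_atoms by simp
  qed
qed

text \<open>\<open>D\<close> consists of zero, the strand \<open>C2\<close> and everything from
  \<open>b\<close> on, and is again a chain. Gluing \<open>B\<close> to it at the same pair gives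
  back \<open>L\<close> with the strands exchanged. Both pieces inherit \<open>le\<close> from
  \<open>L\<close>, so the two orders are compared inside \<open>L\<close>.\<close>

lemma swap:
  defines "D \<equiv> carrier C1 - B \<union> carrier C2"
  shows "finite_chain (suborder L D)" "finite_chain (suborder L B)"
    "is_adjunct L (suborder L D) a b (suborder L B)"
    "between (suborder L D) a b = carrier C2"
proof -
  have B_sub: "B \<subseteq> carrier L" by (auto simp: mem_B_iff)
  have D_sub: "D \<subseteq> carrier L" by (auto simp: D_def)
  have D_cases: "x \<in> carrier C2 \<or> x = \<bottom>\<^bsub>L\<^esub> \<or> x \<in> carrier C1 \<and> b \<sqsubseteq>\<^bsub>C1\<^esub> x" if "x \<in> D" for x
    using that by (auto simp: D_def mem_B_iff)
  have a_D: "a \<in> D" and b_D: "b \<in> D" by (simp_all add: D_def between_def L1.lless_eq)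
  have comparable: "x \<sqsubseteq>\<^bsub>L\<^esub> y \<or> y \<sqsubseteq>\<^bsub>L\<^esub> x" if "x \<in> D" "y \<in> D" for x y
    using D_cases[OF that(1)] D_cases[OF that(2)] that D_sub total1[of x y] total2[of x y]
    by (elim disjE conjE) (simp_all add: le_simps subset_eq)
  show chainD: "finite_chain (suborder L D)"
    using D_sub a_D comparable by (intro L.finite_chain_suborder) auto
  show chainB: "finite_chain (suborder L B)"
    using B_sub B_nonempty total1
    by (intro L.finite_chain_suborder) (simp_all add: mem_B_iff le_simps)
  interpret sD: total_order "suborder L D" using chainD by (simp add: finite_chain_def)
  have lless: "x \<sqsubset>\<^bsub>suborder L D\<^esub> y \<longleftrightarrow> x \<sqsubseteq>\<^bsub>L\<^esub> y \<and> x \<noteq> y" if "x \<in> D" "y \<in> D" for x y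
    using that by (simp add: sD.lless_eq)
  show between: "between (suborder L D) a b = carrier C2"
  proof (intro equalityI subsetI)
    fix x assume "x \<in> between (suborder L D) a b"
    then have x: "x \<in> D" "x \<noteq> a" "x \<noteq> b" "x \<sqsubseteq>\<^bsub>L\<^esub> b"
      using a_D b_D lless by (auto simp: between_def)
    then show "x \<in> carrier C2"
      using D_cases[OF x(1)] L1.le_antisym[of x b] lower by (auto simp: le_simps)
  next
    fix x assume x: "x \<in> carrier C2"
    then have "x \<in> D" by (simp add: D_def)
    moreover have "x \<noteq> a" "x \<noteq> b" using x disjoint a_in b_in by (metis disjoint_iff)+
    ultimately show "x \<in> between (suborder L D) a b"
      using x a_D b_D by (simp add: between_def lless le_simps)
  qed
  \<comment> \<open>The strand \<open>C2\<close>, being nonempty, now keeps \<open>b\<close> from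
    covering \<open>a\<close>.\<close>
  have "\<not> covered_by (suborder L D) a b"
    using between L2.carrier_nonempty by (simp add: covered_by_def)
  moreover have "a \<sqsubset>\<^bsub>suborder L D\<^esub> b"
    using a_D b_D le_ab a_neq_b by (simp add: lless le_simps)
  moreover have disj: "D \<inter> B = {}" using disjoint by (auto simp: D_def mem_B_iff)
  moreover have "same_order L (adjunct (suborder L D) a b (suborder L B))"
  proof -
    have carrier: "carrier L = D \<union> B" by (auto simp: D_def carrier_eq mem_B_iff)
    \<comment> \<open>Only zero in \<open>D\<close> is below an element of \<open>B\<close>:
      elements of \<open>C2\<close> are incomparable with \<open>B\<close>, and no element of
      \<open>B\<close> lies above \<open>b\<close>.\<close>
    have D_B: "x \<sqsubseteq>\<^bsub>L\<^esub> y \<longleftrightarrow> x \<sqsubseteq>\<^bsub>L\<^esub> a" if x: "x \<in> D" and y: "y \<in> B" for x y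
    proof -
      have "x = \<bottom>\<^bsub>L\<^esub>" if le: "x \<sqsubseteq>\<^bsub>L\<^esub> y"
        using D_cases[OF x]
      proof (elim disjE conjE)
        assume "x \<in> carrier C2"
        then show ?thesis using le le_2_B y by blast
      next
        assume x1: "x \<in> carrier C1" "b \<sqsubseteq>\<^bsub>C1\<^esub> x"
        then have "b \<sqsubseteq>\<^bsub>C1\<^esub> y"
          using le y L1.le_trans[of b x y] by (simp add: mem_B_iff le_simps)
        then show ?thesis using y by (simp add: mem_B_iff)
      qed
      moreover have "x \<in> carrier L" "y \<in> carrier L" using x y D_sub B_sub by auto
      ultimately show ?thesis unfolding lower by (auto simp: L.le_bottom_iff)
    qed
    \<comment> \<open>Both sides fail when \<open>y\<close> is in \<open>C2\<close> or zero, and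
      both hold when \<open>y\<close> is in \<open>C1\<close> above \<open>b\<close>.\<close>
    have B_D: "x \<sqsubseteq>\<^bsub>L\<^esub> y \<longleftrightarrow> b \<sqsubseteq>\<^bsub>L\<^esub> y" if x: "x \<in> B" and y: "y \<in> D" for x y
    proof -
      have x1: "x \<in> carrier C1" "x \<sqsubseteq>\<^bsub>C1\<^esub> b" "x \<noteq> \<bottom>\<^bsub>L\<^esub>" using x total1[of x b] by (auto simp: mem_B_iff)
      have b0: "b \<noteq> \<bottom>\<^bsub>L\<^esub>" using lower a_neq_b by simp
      show ?thesis
        using D_cases[OF y]
      proof (elim disjE conjE)
        assume "y \<in> carrier C2"
        then show ?thesis
          using x1 b0 by (simp add: le_simps le_a_iff)
      next
        assume "y = \<bottom>\<^bsub>L\<^esub>"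
        then show ?thesis using x1 b0 by (simp add: L.le_bottom_iff)
      next
        assume "y \<in> carrier C1" "b \<sqsubseteq>\<^bsub>C1\<^esub> y"
        then show ?thesis using x1 L1.le_trans[of x b y] by (simp add: le_simps)
      qed
    qed
    have "eq L = (=)" using L.eq_is_equal .
    then show ?thesis
      unfolding same_order_def adjunct_def using carrier disj D_B B_D by (auto simp del: in_carrier)
  qed
  ultimately show "is_adjunct L (suborder L D) a b (suborder L B)"
    using chainD chainB a_D b_D
    by (simp add: is_adjunct_def finite_chain_imp_finite_lattice)
qed

end

section \<open>Choice of the shorter strand and the case distinction on the girth\<close>

lemma adjunct_rep_Nil: "adjunct_rep [] C \<Longrightarrow> finite_chain C"
  by (erule adjunct_rep.cases) simp_all

lemma adjunct_two_chainsI: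
  assumes "finite_lattice L" "finite_chain C1" "finite_chain C2" "is_adjunct L C1 \<bottom>\<^bsub>L\<^esub> b C2"
  shows "adjunct_two_chains L C1 C2 \<bottom>\<^bsub>L\<^esub> b"
  using assms adjunct_latI[OF assms(1,4)]
  by (simp add: adjunct_two_chains_def adjunct_two_chains_axioms_def)

text \<open>If the glued chain is the longer strand, \<open>swap\<close> makes the other strand the
  glued one.\<close>

lemma shorter_strand_glued:
  assumes "finite_lattice L" "adjunct_rep [(\<bottom>\<^bsub>L\<^esub>, b)] L"
  obtains C1 C2 where "finite_chain C1" "finite_chain C2" "is_adjunct L C1 \<bottom>\<^bsub>L\<^esub> b C2"
    "card (carrier C2) \<le> card (between C1 \<bottom>\<^bsub>L\<^esub> b)"
proof -
  obtain C1 C2 where C: "finite_chain C1" "finite_chain C2" "is_adjunct L C1 \<bottom>\<^bsub>L\<^esub> b C2"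
    using assms(2)
  proof (cases rule: adjunct_rep.cases)
    case (glue ps L1 C a b')
    with that[of L1 C] adjunct_rep_Nil[of L1] show ?thesis by simp
  qed
  then interpret adjunct_two_chains L C1 C2 "\<bottom>\<^bsub>L\<^esub>" b
    using assms(1) by (intro adjunct_two_chainsI)
  show thesis
  proof (cases "card (carrier C2) \<le> card B")
    case True
    with C that show thesis by blast
  next
    case False
    then show thesis using that[OF swap(1-3)] swap(4) by simp
  qed
qed

theorem theorem2p19:
  fixes L :: "'a gorder" and n :: nat
  assumes "finite_lattice L"
    and "lower_dismantlable L"
    and "adjunct_of_chains n L"
    and "n \<ge> 2"
  shows "pverts (zero_divisor_graph L) \<noteq> {} \<and>
    graph_diam (zero_divisor_graph L) \<le> 2 \<and>
    (only_adjunct_pair L (\<bottom>\<^bsub>L\<^esub>, \<top>\<^bsub>L\<^esub>) \<longrightarrow>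
      (graph_diam (zero_divisor_graph L) = 1 \<longleftrightarrow> order_iso L (M_lat n))) \<and>
    (girth (zero_divisor_graph L) = 3 \<longleftrightarrow> (\<exists>m\<ge>3. adjunct_of_chains m L)) \<and>
    (girth (zero_divisor_graph L) = 4 \<longleftrightarrow>
      (\<exists>C1 C2 a. finite_chain C1 \<and> finite_chain C2 \<and> is_adjunct L C1 \<bottom>\<^bsub>L\<^esub> a C2 \<and>
        card (carrier C2) \<le> card (between C1 \<bottom>\<^bsub>L\<^esub> a) \<and> card (carrier C2) \<ge> 2)) \<and>
    (girth (zero_divisor_graph L) = \<infinity> \<longleftrightarrow>
      (\<exists>C1 C2 a. finite_chain C1 \<and> finite_chain C2 \<and> is_adjunct L C1 \<bottom>\<^bsub>L\<^esub> a C2 \<and>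
        card (carrier C2) = 1))"
proof -
  let ?G = "zero_divisor_graph L"
  note fl = assms(1)
  obtain ps where ps: "adjunct_rep ps L" "\<forall>(a, b)\<in>set ps. a = \<bottom>\<^bsub>L\<^esub>"
    using assms(2) by (auto simp: lower_dismantlable_def)
  have upset: "upset_chain L"
    using ps fl by (intro upset_chain_if_lower_rep) auto
  \<comment> \<open>The representation behind \<open>only_adjunct_pair\<close> may differ from
    \<open>ps\<close>, so the dual chain condition is derived from that one.\<close>
  have downset: "downset_chain L" if only: "only_adjunct_pair L (\<bottom>\<^bsub>L\<^esub>, \<top>\<^bsub>L\<^esub>)"
  proof -
    obtain qs where qs: "adjunct_rep qs L" "set qs = {(\<bottom>\<^bsub>L\<^esub>, \<top>\<^bsub>L\<^esub>)}"
      using only unfolding only_adjunct_pair_def by blast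
    have "\<forall>p\<in>set qs. snd p = \<top>\<^bsub>L\<^esub>" unfolding qs(2) by simp
    with qs(1) fl show ?thesis by (rule downset_chain_if_upper_rep)
  qed
  \<comment> \<open>There is one pair fewer than there are chains, so \<open>n \<ge> 2\<close> means
    that at least one chain was glued.\<close>
  have nontrivial: "\<bottom>\<^bsub>L\<^esub> \<noteq> \<top>\<^bsub>L\<^esub>"
    using assms(3,4) bottom_neq_top_if_glued[OF _ fl] by (fastforce simp: adjunct_of_chains_def)
  \<comment> \<open>The number of chains is thus an invariant of \<open>L\<close>: both
    \<open>n\<close> and any \<open>m\<close> in (a) equal the number of atoms.\<close>
  have chains: "m = card (atoms L)" if "adjunct_of_chains m L" for m
    using that card_atoms_eq[OF _ fl upset nontrivial] by (auto simp: adjunct_of_chains_def)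
  have card_atoms: "card (atoms L) = n" using chains assms(3) by simp
  have atoms2: "2 \<le> card (atoms L)" using card_atoms assms(4) by simp
  interpret T: up_tree L
    using fl upset by (simp add: up_tree_def up_tree_axioms_def finite_lat_iff)
  have "atoms L \<noteq> {}" using atoms2 by auto
  then have nonempty: "pverts ?G \<noteq> {}" using T.atoms_subset_verts[OF atoms2] by blast
  have diam1: "graph_diam ?G = 1 \<longleftrightarrow> order_iso L (M_lat n)"
    if "only_adjunct_pair L (\<bottom>\<^bsub>L\<^esub>, \<top>\<^bsub>L\<^esub>)"
    using T.diam_eq_1_iff[OF downset[OF that] atoms2] card_atoms by simp
  have girth3: "girth ?G = 3 \<longleftrightarrow> (\<exists>m\<ge>3. adjunct_of_chains m L)"
    unfolding T.girth_eq_3_iff using chains assms(3) by metis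
  have infinity: "girth ?G = \<infinity>"
    if "finite_chain C1" "finite_chain C2" "is_adjunct L C1 \<bottom>\<^bsub>L\<^esub> a C2" "card (carrier C2) = 1"
    for C1 C2 a
    using adjunct_two_chains.girth_infinity[OF adjunct_two_chainsI[OF fl that(1-3)]] that(4) .
  have four: "girth ?G = 4"
    if "finite_chain C1" "finite_chain C2" "is_adjunct L C1 \<bottom>\<^bsub>L\<^esub> a C2"
      "card (carrier C2) \<le> card (between C1 \<bottom>\<^bsub>L\<^esub> a)" "2 \<le> card (carrier C2)" for C1 C2 a
    using adjunct_two_chains.girth_4[OF adjunct_two_chainsI[OF fl that(1-3)]] that(4,5) by simp
  \<comment> \<open>A girth other than 3 leaves two chains, that is, a single pair in
    \<open>ps\<close>. The shorter strand is nonempty, so it has one element or at least two, and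
    these alternatives separate girth \<infinity> from girth 4.\<close>
  have short: "\<exists>C1 C2 a. finite_chain C1 \<and> finite_chain C2 \<and> is_adjunct L C1 \<bottom>\<^bsub>L\<^esub> a C2 \<and>
      card (carrier C2) \<le> card (between C1 \<bottom>\<^bsub>L\<^esub> a) \<and>
      (card (carrier C2) = 1 \<or> 2 \<le> card (carrier C2))"
    if "girth ?G \<noteq> 3"
  proof -
    have "n = 2" using that T.girth_eq_3_iff card_atoms assms(4) by simp
    then have "length ps = 1"
      using card_atoms_eq[OF ps(1) fl upset nontrivial] card_atoms by simp
    then obtain b where "ps = [(\<bottom>\<^bsub>L\<^esub>, b)]" using ps(2) by (auto simp: length_Suc_conv)
    with ps(1) obtain C1 C2 where C: "finite_chain C1" "finite_chain C2"
      "is_adjunct L C1 \<bottom>\<^bsub>L\<^esub> b C2" "card (carrier C2) \<le> card (between C1 \<bottom>\<^bsub>L\<^esub> b)"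
      using shorter_strand_glued[OF fl] by metis
    have "card (carrier C2) \<noteq> 0" using C(2) by (simp add: finite_chain_def)
    then have "card (carrier C2) = 1 \<or> 2 \<le> card (carrier C2)" by linarith
    with C show ?thesis by blast
  qed
  have girth4: "girth ?G = 4 \<longleftrightarrow>
      (\<exists>C1 C2 a. finite_chain C1 \<and> finite_chain C2 \<and> is_adjunct L C1 \<bottom>\<^bsub>L\<^esub> a C2 \<and>
        card (carrier C2) \<le> card (between C1 \<bottom>\<^bsub>L\<^esub> a) \<and> card (carrier C2) \<ge> 2)" (is "_ \<longleftrightarrow> ?R")
  proof
    assume "girth ?G = 4"
    then have "girth ?G \<noteq> 3" "girth ?G \<noteq> \<infinity>" by simp_all
    \<comment> \<open>The alternative with a one-element strand is ruled out, as it would make the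
      girth infinite.\<close>
    then show ?R using short infinity by meson
  next
    assume ?R
    then show "girth ?G = 4" by (elim exE conjE) (rule four)
  qed
  have girth_infinity: "girth ?G = \<infinity> \<longleftrightarrow>
      (\<exists>C1 C2 a. finite_chain C1 \<and> finite_chain C2 \<and> is_adjunct L C1 \<bottom>\<^bsub>L\<^esub> a C2 \<and>
        card (carrier C2) = 1)" (is "_ \<longleftrightarrow> ?R")
  proof
    assume "girth ?G = \<infinity>"
    then have "girth ?G \<noteq> 3" "girth ?G \<noteq> 4" by simp_all
    then show ?R using short four by meson
  next
    assume ?R
    then show "girth ?G = \<infinity>" by (elim exE conjE) (rule infinity)
  qed
  show ?thesis
    by (intro conjI impI nonempty T.diam_le_2 diam1 girth3 girth4 girth_infinity)
qed

end
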